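(* Let $k$ be a field of characteristic two, and let $\alpha\in k_{alg}$ be an algebraic element of degree $n$ over $k$, with minimal polynomial $f\in k[X]$. Then: (1) if $f$ is separable, $\alpha$ is an eigenvalue of a symmetric matrix of $\mathrm{M}_n(k)$; (2) if $f$ is inseparable, $\alpha$ is an eigenvalue of a symmetric matrix of $\mathrm{M}_{n+1}(k)$, but not of any symmetric matrix of $\mathrm{M}_n(k)$. In particular, if $k$ is perfect, any element of $k_{alg}$ of degree $n$ over $k$ is an eigenvalue of a symmetric matrix of $\mathrm{M}_n(k)$.
   Context: $k_{alg}$ is a fixed algebraic closure of $k$, and $\mathrm{M}_n(k)$ denotes the ring of $n\times n$ matrices with entries in $k$. Eigenvalues of a matrix with entries in $k$ are taken in $k_{alg}$. An irreducible polynomial of $k[X]$ is separable if it has no multiple root in $k_{alg}$, and inseparable otherwise. *)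

theory Defs
  imports "HOL-Algebra.Algebraic_Closure_Type" "Jordan_Normal_Form.Char_Poly"
begin

definition is_min_poly :: "'k::field poly \<Rightarrow> 'k alg_closure \<Rightarrow> bool" where
  "is_min_poly f \<alpha> \<longleftrightarrow>
     Polynomial.lead_coeff f = 1 \<and> poly (map_poly to_ac f) \<alpha> = 0 \<and>
     (\<forall>g. g \<noteq> 0 \<and> poly (map_poly to_ac g) \<alpha> = 0 \<longrightarrow>
          Polynomial.degree f \<le> Polynomial.degree g)"

definition min_poly :: "'k::field alg_closure \<Rightarrow> 'k poly" where
  "min_poly \<alpha> = (THE f. is_min_poly f \<alpha>)"

lemma ex1_min_poly: "\<exists>!f. is_min_poly f \<alpha>"
proof -
  let ?ev = "\<lambda>f. poly (map_poly to_ac f) \<alpha>"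
  let ?P = "\<lambda>n. \<exists>f. f \<noteq> 0 \<and> ?ev f = 0 \<and> Polynomial.degree f = n"
  have smult: "?ev (Polynomial.smult c f) = to_ac c * ?ev f" for c f
  proof -
    have "map_poly to_ac (Polynomial.smult c f) = Polynomial.smult (to_ac c) (map_poly to_ac f)"
      by (rule poly_eqI) (simp add: coeff_map_poly)
    thus ?thesis by simp
  qed
  have diff: "?ev (f - g) = ?ev f - ?ev g" for f g
  proof -
    have "map_poly to_ac (f - g) = map_poly to_ac f - map_poly to_ac g"
      by (rule poly_eqI) (simp add: coeff_map_poly)
    thus ?thesis by simp
  qed
  obtain p where "p \<noteq> 0" "?ev p = 0"
    using alg_closure_algebraic by blast
  hence "\<exists>n. ?P n" by blast
  hence least: "?P (LEAST n. ?P n)" by (rule LeastI_ex)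
  then obtain f where f: "f \<noteq> 0" "?ev f = 0" "Polynomial.degree f = (LEAST n. ?P n)"
    by blast
  have min: "Polynomial.degree f \<le> Polynomial.degree g" if "g \<noteq> 0" "?ev g = 0" for g
    unfolding f(3) using that by (intro Least_le) blast
  let ?f = "Polynomial.smult (inverse (Polynomial.lead_coeff f)) f"
  have "is_min_poly ?f \<alpha>"
    unfolding is_min_poly_def smult using f(1,2) min by simp
  moreover have "g = h" if g: "is_min_poly g \<alpha>" and h: "is_min_poly h \<alpha>" for g h
  proof (rule ccontr)
    assume "g \<noteq> h"
    have "g \<noteq> 0" "h \<noteq> 0" using g h by (auto simp: is_min_poly_def)
    hence deg: "Polynomial.degree g = Polynomial.degree h"
      using g h by (intro antisym) (auto simp: is_min_poly_def)
    have "g - h \<noteq> 0" "?ev (g - h) = 0"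
      using \<open>g \<noteq> h\<close> g h diff[of g h] by (auto simp: is_min_poly_def)
    hence le: "Polynomial.degree g \<le> Polynomial.degree (g - h)"
      using g by (auto simp: is_min_poly_def)
    moreover have "Polynomial.degree (g - h) \<le> Polynomial.degree g"
      using degree_diff_le_max[of g h] deg by simp
    ultimately have "Polynomial.degree (g - h) = Polynomial.degree g" by simp
    hence "Polynomial.lead_coeff (g - h) = 0"
      using g h deg by (simp add: is_min_poly_def)
    thus False using \<open>g - h \<noteq> 0\<close> by (simp only: leading_coeff_0_iff)
  qed
  ultimately show ?thesis by blast
qed

lemma is_min_poly_min_poly: "is_min_poly (min_poly \<alpha>) \<alpha>"
  unfolding min_poly_def by (rule theI'[OF ex1_min_poly])

definition alg_degree :: "'k::field alg_closure \<Rightarrow> nat" where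
  "alg_degree \<alpha> = Polynomial.degree (min_poly \<alpha>)"

(* Intended for irreducible polynomials only; inseparable is the negation. *)
definition separable_poly :: "'k::field poly \<Rightarrow> bool" where
  "separable_poly f \<longleftrightarrow> \<not> (\<exists>x. 2 \<le> Polynomial.order x (map_poly to_ac f))"

definition perfect_field :: "'k::field itself \<Rightarrow> bool" where
  "perfect_field _ \<longleftrightarrow> (\<forall>p :: 'k poly. Factorial_Ring.irreducible p \<longrightarrow> separable_poly p)"

definition symmetric_mat :: "'a mat \<Rightarrow> bool" where
  "symmetric_mat A \<longleftrightarrow> transpose_mat A = A"

(* The eigenvalue is taken in the algebraic closure of the field of coefficients. *)
definition ac_eigenvalue :: "'k::field mat \<Rightarrow> 'k alg_closure \<Rightarrow> bool" where
  "ac_eigenvalue A \<alpha> \<longleftrightarrow> eigenvalue (map_mat to_ac A) \<alpha>"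

end

theory Submission
  imports Defs "HOL-Computational_Algebra.Formal_Power_Series"
begin

text \<open>
  A symmetric matrix with eigenvalue \<open>\<alpha>\<close> comes from a non-degenerate symmetric bilinear form on
  \<open>k(\<alpha>)\<close> for which multiplication by \<open>\<alpha>\<close> is self-adjoint and which has an orthonormal basis.
  Such forms are \<open>(x, y) \<mapsto> P(x y)\<close> for a nonzero linear functional \<open>P\<close>; in the basis of powers of
  \<open>\<alpha>\<close> they are the Hankel matrices of nonzero sequences \<open>P\<close> satisfying the linear recurrence \<open>f\<close>.
  In characteristic two, a symmetric form has a Gram factorization as soon as it is not
  alternating and its diagonal consists of squares. If \<open>f\<close> is separable, the trace sequence, whose
  generating function is \<open>f'/f\<close> expanded at infinity, satisfies \<open>P (2 i) = (P i)\<^sup>2\<close>. If \<open>f\<close> is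
  inseparable, it is a polynomial in \<open>X\<^sup>2\<close>, and some nonzero sequence vanishes at all even indices;
  the alternating form obtained this way has a Gram factorization after adding a unit vector.

  Conversely, let \<open>f\<close> be inseparable and let \<open>A\<close> be a symmetric \<open>n \<times> n\<close> matrix with eigenvector \<open>v\<close>,
  \<open>v\<^sub>r \<noteq> 0\<close>. By symmetry the \<open>(r, r)\<close> entry of \<open>A\<^bsup>2i\<^esup>\<close> is the square of the sum \<open>P i\<close> of the \<open>r\<close>-th row
  of \<open>A\<^sup>i\<close>. Taking square roots over the algebraic closure in the recurrence for these entries, the
  sequence \<open>P\<close> satisfies a recurrence of order \<open>n/2\<close>, so its Hankel determinant vanishes and \<open>P = 0\<close>,
  although the \<open>r\<close>-th rows of the powers of \<open>A\<close> span \<open>k\<^sup>n\<close>.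
\<close>

interpretation to_ac: inj_idom_hom "to_ac :: 'k::field \<Rightarrow> 'k alg_closure"
  by unfold_locales auto

interpretation to_ac_poly: map_poly_inj_idom_hom "to_ac :: 'k::field \<Rightarrow> 'k alg_closure" ..

subsection \<open>Gram factorization in characteristic two\<close>

lemma double_eq_0_char2:
  fixes x :: "'a::field"
  assumes "CHAR('a) = 2"
  shows "x + x = 0"
proof -
  have "of_nat 2 = (0::'a)" using of_nat_CHAR[where ?'a = 'a] assms by simp
  hence "(2::'a) = 0" by simp
  thus ?thesis by (metis mult_2 mult_zero_left)
qed

lemma square_diff_char2:
  fixes x y :: "'a::field"
  assumes "CHAR('a) = 2"
  shows "(x - y)\<^sup>2 = x\<^sup>2 - y\<^sup>2"
proof -
  have "(x - y)\<^sup>2 = x\<^sup>2 - y\<^sup>2 + (y * y + y * y) - (x * y + x * y)"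
    by (simp add: power2_eq_square algebra_simps)
  thus ?thesis by (simp add: double_eq_0_char2[OF assms])
qed

lemma square_add_char2:
  fixes x y :: "'a::field"
  assumes "CHAR('a) = 2"
  shows "(x + y)\<^sup>2 = x\<^sup>2 + y\<^sup>2"
proof -
  have "(x + y)\<^sup>2 = x\<^sup>2 + y\<^sup>2 + (x * y + x * y)"
    by (simp add: power2_eq_square algebra_simps)
  thus ?thesis by (simp add: double_eq_0_char2[OF assms])
qed

lemma square_sum_char2:
  fixes g :: "'i \<Rightarrow> 'a::field"
  assumes "CHAR('a) = 2"
  shows "(\<Sum>i\<in>I. g i)\<^sup>2 = (\<Sum>i\<in>I. (g i)\<^sup>2)"
  by (induction I rule: infinite_finite_induct) (simp_all add: square_add_char2[OF assms])

text \<open>Induction on the size of \<open>I\<close>: split off one column of the factor at a pivot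
  and pass to the Schur complement. Squaring is additive in characteristic two, so the diagonal of
  the complement again consists of squares; the pivot has to be chosen so that the complement is not
  alternating.\<close>

lemma gram_factor:
  fixes h :: "'i \<Rightarrow> 'i \<Rightarrow> 'a::field"
  assumes char2: "CHAR('a) = 2" and "finite I"
    and "\<And>i j. i \<in> I \<Longrightarrow> j \<in> I \<Longrightarrow> h i j = h j i"
    and "\<And>i. i \<in> I \<Longrightarrow> h i i = (a i)\<^sup>2"
    and "\<exists>i\<in>I. a i \<noteq> 0"
  shows "\<exists>w. \<forall>i\<in>I. \<forall>j\<in>I. h i j = (\<Sum>s\<in>I. w i s * w j s)"
  using assms(2-)
proof (induction "card I" arbitrary: I h a rule: less_induct)
  case less
  note fin = less.prems(1)
  \<comment> \<open>Stated for arbitrary \<open>h\<close> and \<open>a\<close> because it is used a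
    second time after a change of basis. The condition on \<open>q\<close> says exactly that the
    complement has a nonzero diagonal entry at \<open>q\<close>.\<close>
  have pivot: "\<exists>w. \<forall>i\<in>I. \<forall>j\<in>I. h i j = (\<Sum>s\<in>I. w i s * w j s)"
    if sym: "\<And>i j. i \<in> I \<Longrightarrow> j \<in> I \<Longrightarrow> h i j = h j i"
      and diag: "\<And>i. i \<in> I \<Longrightarrow> h i i = (a i)\<^sup>2"
      and p: "p \<in> I" "a p \<noteq> 0" and q: "q \<in> I" "h p q \<noteq> a p * a q"
    for h :: "'i \<Rightarrow> 'i \<Rightarrow> 'a" and a p q
  proof -
    let ?J = "I - {p}"
    \<comment> \<open>The column to split off: \<open>c i * c j\<close> agrees with
      \<open>h i j\<close> as soon as \<open>i\<close> or \<open>j\<close> is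
      \<open>p\<close>.\<close>
    define c where "c i = h i p / a p" for i
    define h' where "h' i j = h i j - c i * c j" for i j
    have cp: "c p = a p" using diag[OF p(1)] p(2) by (simp add: c_def power2_eq_square)
    have "q \<noteq> p" using q diag[OF p(1)] by (auto simp: power2_eq_square)
    have "\<exists>w. \<forall>i\<in>?J. \<forall>j\<in>?J. h' i j = (\<Sum>s\<in>?J. w i s * w j s)"
    proof (rule less.hyps)
      show "card ?J < card I" using fin p(1) by (meson card_Diff1_less)
      show "finite ?J" using fin by simp
      show "h' i j = h' j i" if "i \<in> ?J" "j \<in> ?J" for i j
        using sym that by (simp add: h'_def)
      show "h' i i = (a i - c i)\<^sup>2" if "i \<in> ?J" for i
        using diag that by (simp add: h'_def square_diff_char2[OF char2] power2_eq_square[of "c i"])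
      show "\<exists>i\<in>?J. a i - c i \<noteq> 0"
      proof (intro bexI)
        show "a q - c q \<noteq> 0" using q sym[OF p(1) q(1)] p(2) by (auto simp: c_def field_simps)
        show "q \<in> ?J" using q(1) \<open>q \<noteq> p\<close> by simp
      qed
    qed
    then obtain w where w: "\<And>i j. i \<in> ?J \<Longrightarrow> j \<in> ?J \<Longrightarrow> h' i j = (\<Sum>s\<in>?J. w i s * w j s)"
      by blast
    define w' where "w' i s = (if s = p then c i else if i = p then 0 else w i s)" for i s
    have "h i j = (\<Sum>s\<in>I. w' i s * w' j s)" if ij: "i \<in> I" "j \<in> I" for i j
    proof -
      have "(\<Sum>s\<in>I. w' i s * w' j s) = c i * c j + (\<Sum>s\<in>?J. w' i s * w' j s)"
        using fin p(1) by (subst sum.remove[of _ p]) (auto simp: w'_def)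
      also have "(\<Sum>s\<in>?J. w' i s * w' j s) = h i j - c i * c j"
      proof (cases "i = p \<or> j = p")
        case True
        have "(\<Sum>s\<in>?J. w' i s * w' j s) = 0" using True by (intro sum.neutral) (auto simp: w'_def)
        moreover have "h i j = c i * c j"
          using True
        proof
          assume "i = p"
          thus ?thesis using sym[OF ij] p(2) by (simp add: cp) (simp add: c_def)
        next
          assume "j = p"
          thus ?thesis using p(2) by (simp add: cp) (simp add: c_def)
        qed
        ultimately show ?thesis by simp
      next
        case False
        hence "(\<Sum>s\<in>?J. w' i s * w' j s) = (\<Sum>s\<in>?J. w i s * w j s)"
          by (intro sum.cong) (auto simp: w'_def)
        also have "\<dots> = h' i j" using False ij w[of i j] by simp
        finally show ?thesis by (simp add: h'_def)
      qed
      finally show ?thesis by simp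
    qed
    thus ?thesis by blast
  qed
  obtain p where p: "p \<in> I" "a p \<noteq> 0" using less.prems(4) by blast
  note sym = less.prems(2) and diag = less.prems(3)
  show ?case
  proof (cases "\<forall>i\<in>I. \<forall>j\<in>I. h i j = a i * a j")
    case True
    have "h i j = (\<Sum>s\<in>I. (if s = p then a i else 0) * (if s = p then a j else 0))"
      if "i \<in> I" "j \<in> I" for i j
    proof -
      have "(\<Sum>s\<in>I. (if s = p then a i else 0) * (if s = p then a j else 0))
          = (\<Sum>s\<in>I. if s = p then a i * a j else 0)" by (rule sum.cong) auto
      thus ?thesis using True that fin p(1) by simp
    qed
    thus ?thesis by (intro exI[of _ "\<lambda>i s. if s = p then a i else 0"]) blast
  next
    case False
    then obtain q r where qr: "q \<in> I" "r \<in> I" "h q r \<noteq> a q * a r" by blast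
    show ?thesis
    proof (cases "\<exists>i\<in>I. \<exists>j\<in>I. a i \<noteq> 0 \<and> h i j \<noteq> a i * a j")
      case True
      then obtain i j where "i \<in> I" "j \<in> I" "a i \<noteq> 0" "h i j \<noteq> a i * a j" by blast
      thus ?thesis by (intro pivot[where h = h and a = a and p = i and q = j] sym diag)
    next
      case False
      \<comment> \<open>Every basis vector with \<open>a i \<noteq> 0\<close> is useless as a pivot, so replace the isotropic
        vector \<open>e q\<close> by \<open>e q + e p\<close>, which is a good one.\<close>
      have rows: "h i j = a i * a j" if "i \<in> I" "j \<in> I" "a i \<noteq> 0" for i j
        using False that by blast
      have aq: "a q = 0" using rows[OF qr(1,2)] qr(3) by blast
      have ar: "a r = 0" using rows[OF qr(2,1)] qr(3) sym[OF qr(1,2)] by (auto simp: mult.commute)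
      have qp: "q \<noteq> p" using aq p by auto
      have rq: "r \<noteq> q" using qr(3) diag[OF qr(1)] by (auto simp: power2_eq_square)
      define T where "T v i = (if i = q then v q + v p else v i)" for v :: "'i \<Rightarrow> 'a" and i
      \<comment> \<open>The Gram matrix after the base change, with \<open>T\<close> applied in each
        argument. As \<open>a q = 0\<close>, the new diagonal root at \<open>q\<close> is
        \<open>a p\<close>; as \<open>h p r = 0\<close>, the entry at \<open>q\<close>,
        \<open>r\<close> stays nonzero while \<open>a r = 0\<close>.\<close>
      define h' where "h' i j = T (\<lambda>k. T (h k) j) i" for i j
      define a' where "a' = a(q := a p)"
      have hqp: "h q p = 0" "h p q = 0"
        using rows[OF p(1) qr(1) p(2)] aq sym[OF p(1) qr(1)] by auto
      have hqq: "h q q = 0" using diag[OF qr(1)] aq by simp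
      have "\<exists>w. \<forall>i\<in>I. \<forall>j\<in>I. h' i j = (\<Sum>s\<in>I. w i s * w j s)"
      proof (rule pivot[where p = q and q = r and a = a'])
        show "h' i j = h' j i" if "i \<in> I" "j \<in> I" for i j
          using sym[OF that] sym[OF that(1) qr(1)] sym[OF that(1) p(1)]
            sym[OF that(2) qr(1)] sym[OF that(2) p(1)] hqp
          by (auto simp: h'_def T_def)
        show "h' i i = (a' i)\<^sup>2" if "i \<in> I" for i
          using diag[OF that] diag[OF p(1)] hqp hqq by (auto simp: h'_def T_def a'_def)
        show "q \<in> I" "r \<in> I" "a' q \<noteq> 0" using qr p by (auto simp: a'_def)
        have "h p r = 0" using rows[OF p(1) qr(2) p(2)] ar by simp
        thus "h' q r \<noteq> a' q * a' r"
          using rq qr(3) ar aq by (auto simp: h'_def T_def a'_def)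
      qed
      then obtain w where w: "\<And>i j. i \<in> I \<Longrightarrow> j \<in> I \<Longrightarrow> h' i j = (\<Sum>s\<in>I. w i s * w j s)"
        by blast
      \<comment> \<open>Undoes the base change: the old vector at \<open>q\<close> is the new one
        minus the vector at \<open>p\<close>.\<close>
      define w' where "w' i s = (if i = q then w q s - w p s else w i s)" for i s
      have h'_eqs: "h' q q = a p * a p" "h' q p = a p * a p" "h' p q = a p * a p" "h' p p = a p * a p"
        using hqp hqq qp diag[OF p(1)] by (auto simp: h'_def T_def power2_eq_square)
      have "h i j = (\<Sum>s\<in>I. w' i s * w' j s)" if ij: "i \<in> I" "j \<in> I" for i j
      proof -
        have T': "(\<Sum>s\<in>I. w' i s * w' j s) =
            (if i = q \<and> j = q then h' q q - h' q p - h' p q + h' p p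
             else if i = q then h' q j - h' p j else if j = q then h' i q - h' i p else h' i j)"
          using w[OF ij] w[OF ij(1) p(1)] w[OF ij(1) qr(1)] w[OF p(1) ij(2)] w[OF qr(1) ij(2)]
            w[OF p(1) p(1)] w[OF qr(1) qr(1)] w[OF p(1) qr(1)] w[OF qr(1) p(1)]
          by (simp add: w'_def algebra_simps sum.distrib sum_subtractf sum_distrib_left)
        show ?thesis unfolding T' h'_eqs
          using hqq qp by (auto simp: h'_def T_def)
      qed
      thus ?thesis by blast
    qed
  qed
qed

subsection \<open>Minimal polynomials\<close>

lemma is_min_poly_nonzero: "is_min_poly f \<alpha> \<Longrightarrow> f \<noteq> 0"
  by (auto simp: is_min_poly_def)

lemma is_min_poly_eq_0:
  assumes "is_min_poly f \<alpha>" "poly (map_poly to_ac g) \<alpha> = 0"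
    and "Polynomial.degree g < Polynomial.degree f"
  shows "g = 0"
  using assms by (force simp: is_min_poly_def)

lemma is_min_poly_degree_pos:
  assumes "is_min_poly f \<alpha>"
  shows "0 < Polynomial.degree f"
proof (rule ccontr)
  assume "\<not> ?thesis"
  then obtain c where "f = [:c:]" by (auto elim: degree_eq_zeroE)
  thus False using assms by (auto simp: is_min_poly_def)
qed

lemma is_min_poly_dvd:
  assumes "is_min_poly f \<alpha>" "poly (map_poly to_ac g) \<alpha> = 0"
  shows "f dvd g"
proof -
  have "g = f * (g div f) + g mod f" by simp
  hence "poly (map_poly to_ac g) \<alpha> = poly (map_poly to_ac f) \<alpha> * poly (map_poly to_ac (g div f)) \<alpha>
      + poly (map_poly to_ac (g mod f)) \<alpha>"
    by (metis to_ac_poly.hom_add to_ac_poly.hom_mult poly_add poly_mult)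
  hence "poly (map_poly to_ac (g mod f)) \<alpha> = 0" using assms by (simp add: is_min_poly_def)
  hence "g mod f = 0"
    using is_min_poly_eq_0[OF assms(1)] degree_mod_less'[OF is_min_poly_nonzero[OF assms(1)]] by blast
  thus ?thesis by auto
qed

text \<open>\<alpha> is a root of one of the two factors, and by minimality that factor has the full
  degree.\<close>

lemma is_min_poly_factor:
  assumes "is_min_poly f \<alpha>" "f = g * h"
  shows "Polynomial.degree g = 0 \<or> Polynomial.degree h = 0"
proof -
  have nz: "g \<noteq> 0" "h \<noteq> 0" using is_min_poly_nonzero[OF assms(1)] assms(2) by auto
  hence deg: "Polynomial.degree f = Polynomial.degree g + Polynomial.degree h"
    using assms(2) by (simp add: degree_mult_eq)
  have "poly (map_poly to_ac g) \<alpha> * poly (map_poly to_ac h) \<alpha> = 0"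
    using assms by (simp add: is_min_poly_def to_ac_poly.hom_mult)
  thus ?thesis using is_min_poly_eq_0[OF assms(1)] nz deg by fastforce
qed

lemma irreducible_is_min_poly:
  assumes "is_min_poly f \<alpha>"
  shows "Factorial_Ring.irreducible f"
proof (rule Factorial_Ring.irreducibleI)
  show "f \<noteq> 0" by (rule is_min_poly_nonzero[OF assms])
  show "\<not> f dvd 1" using is_min_poly_degree_pos[OF assms] by (auto simp: is_unit_iff_degree \<open>f \<noteq> 0\<close>)
  show "g dvd 1 \<or> h dvd 1" if "f = g * h" for g h
  proof -
    have "g \<noteq> 0" "h \<noteq> 0" using that \<open>f \<noteq> 0\<close> by auto
    thus ?thesis using is_min_poly_factor[OF assms that] by (simp add: is_unit_iff_degree)
  qed
qed

text \<open>A multiple root is a root of \<open>f\<close> and of its derivative, which has smaller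
  degree, so irreducibility forces the derivative to vanish. Conversely, a zero derivative makes
  \<alpha> itself a double root.\<close>

lemma separable_is_min_poly_iff:
  fixes f :: "'k::field poly"
  assumes "is_min_poly f \<alpha>"
  shows "separable_poly f \<longleftrightarrow> pderiv f \<noteq> 0"
proof -
  let ?F = "map_poly to_ac :: 'k poly \<Rightarrow> _"
  have F0: "?F f \<noteq> 0" using is_min_poly_nonzero[OF assms] by simp
  have "pderiv f = 0" if "2 \<le> Polynomial.order \<beta> (?F f)" for \<beta>
  proof -
    have "[:-\<beta>, 1:]^2 dvd ?F f" using that by (simp add: order_divides)
    then obtain h where h: "?F f = [:-\<beta>, 1:]^2 * h" by (elim dvdE)
    have root: "poly (?F f) \<beta> = 0" by (simp add: h)
    have "poly (pderiv (?F f)) \<beta> = 0"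
      unfolding h pderiv_mult power2_eq_square by simp
    hence droot: "poly (?F (pderiv f)) \<beta> = 0" by (simp add: to_ac.map_poly_pderiv)
    \<comment> \<open>The double root need not be \<alpha>, so minimality is applied to its own
      minimal polynomial, which divides \<open>f\<close> and has the same degree.\<close>
    let ?g = "min_poly \<beta>"
    note g = is_min_poly_min_poly[of \<beta>]
    obtain h where h: "f = ?g * h" using is_min_poly_dvd[OF g root] by (elim dvdE)
    have nz: "?g \<noteq> 0" "h \<noteq> 0" using is_min_poly_nonzero[OF assms] h by auto
    have "Polynomial.degree h = 0"
      using is_min_poly_factor[OF assms h] is_min_poly_degree_pos[OF g] by simp
    hence "Polynomial.degree f = Polynomial.degree ?g"
      using arg_cong[OF h, of Polynomial.degree] nz by (simp add: degree_mult_eq)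
    hence "Polynomial.degree (pderiv f) < Polynomial.degree ?g"
      using is_min_poly_degree_pos[OF g] degree_pderiv_le[of f] by linarith
    thus ?thesis using is_min_poly_eq_0[OF g droot] by blast
  qed
  moreover have "2 \<le> Polynomial.order \<alpha> (?F f)" if "pderiv f = 0"
  proof -
    have "poly (?F f) \<alpha> = 0" using assms by (simp add: is_min_poly_def)
    then obtain q where q: "?F f = [:-\<alpha>, 1:] * q" by (auto simp: poly_eq_0_iff_dvd)
    have "pderiv (?F f) = ?F (pderiv f)" by (rule to_ac.map_poly_pderiv[symmetric])
    hence "poly (pderiv (?F f)) \<alpha> = 0" using that by simp
    moreover have "poly (pderiv (?F f)) \<alpha> = poly q \<alpha>"
      unfolding q pderiv_mult by (simp add: pderiv_pCons)
    ultimately have "poly q \<alpha> = 0" by simp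
    then obtain h where "q = [:-\<alpha>, 1:] * h" by (auto simp: poly_eq_0_iff_dvd)
    hence "[:-\<alpha>, 1:]^2 dvd ?F f" unfolding q power2_eq_square by (metis dvd_triv_left mult.assoc)
    thus ?thesis using F0 by (simp add: order_divides)
  qed
  ultimately show ?thesis unfolding separable_poly_def by blast
qed

subsection \<open>Hankel determinants of recurrent sequences\<close>

text \<open>The linear functional on polynomials that takes the value \<open>P i\<close> at the
  \<open>i\<close>-th power of the variable. That \<open>P\<close> satisfies the recurrence
  \<open>f\<close> means that it vanishes on all multiples of \<open>f\<close>.\<close>

definition seq_pairing :: "(nat \<Rightarrow> 'a::comm_ring_1) \<Rightarrow> 'a poly \<Rightarrow> 'a" where
  "seq_pairing P g = (\<Sum>i\<le>Polynomial.degree g. Polynomial.coeff g i * P i)"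

lemma seq_pairing_eq_sum:
  assumes "Polynomial.degree g \<le> N"
  shows "seq_pairing P g = (\<Sum>i\<le>N. Polynomial.coeff g i * P i)"
  unfolding seq_pairing_def using assms
  by (intro sum.mono_neutral_left) (auto simp: coeff_eq_0)

lemma seq_pairing_add: "seq_pairing P (g + h) = seq_pairing P g + seq_pairing P h"
proof -
  let ?N = "max (Polynomial.degree g) (Polynomial.degree h)"
  have "Polynomial.degree (g + h) \<le> ?N" by (rule degree_add_le_max)
  thus ?thesis by (simp add: seq_pairing_eq_sum[where N = ?N] sum.distrib distrib_right)
qed

lemma seq_pairing_smult: "seq_pairing P (Polynomial.smult c g) = c * seq_pairing P g"
  by (simp add: seq_pairing_eq_sum[where N = "Polynomial.degree g"] degree_smult_le
      sum_distrib_left mult.assoc)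

lemma seq_pairing_0 [simp]: "seq_pairing P 0 = 0"
  by (simp add: seq_pairing_def)

lemma seq_pairing_sum: "seq_pairing P (\<Sum>i\<in>I. g i) = (\<Sum>i\<in>I. seq_pairing P (g i))"
  by (induction I rule: infinite_finite_induct) (simp_all add: seq_pairing_add)

lemma seq_pairing_monom_1 [simp]: "seq_pairing P (Polynomial.monom 1 j) = P j"
  by (simp add: seq_pairing_eq_sum[OF degree_monom_le] if_distrib[of "\<lambda>c. c * _"] cong: if_cong)

lemma seq_pairing_mult:
  assumes "Polynomial.degree h \<le> N"
  shows "seq_pairing P (g * h)
    = (\<Sum>j\<le>N. Polynomial.coeff h j * seq_pairing P (g * Polynomial.monom 1 j))"
proof -
  have "h = (\<Sum>j\<le>N. Polynomial.monom (Polynomial.coeff h j) j)"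
    using assms by (simp add: poly_as_sum_of_monoms')
  also have "\<dots> = (\<Sum>j\<le>N. Polynomial.smult (Polynomial.coeff h j) (Polynomial.monom 1 j))"
    by (simp add: smult_monom)
  finally have "g * h = (\<Sum>j\<le>N. Polynomial.smult (Polynomial.coeff h j) (g * Polynomial.monom 1 j))"
    by (metis (no_types, lifting) mult_smult_right sum.cong sum_distrib_left)
  thus ?thesis by (simp add: seq_pairing_sum seq_pairing_smult)
qed

lemma seq_pairing_mult_monom:
  assumes "Polynomial.degree g \<le> N"
  shows "seq_pairing P (g * Polynomial.monom 1 j) = (\<Sum>i\<le>N. Polynomial.coeff g i * P (i + j))"
proof -
  have "seq_pairing P (g * Polynomial.monom 1 j) = seq_pairing P (Polynomial.monom 1 j * g)"
    by (simp add: mult.commute)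
  also have "\<dots> = (\<Sum>i\<le>N. Polynomial.coeff g i * P (i + j))"
    by (simp add: seq_pairing_mult[OF assms] mult_monom add.commute)
  finally show ?thesis .
qed

text \<open>The polynomials all of whose multiples are killed by the functional form an ideal
  containing \<open>f\<close>. A kernel vector of the Hankel matrix would give it a nonzero element
  of degree below \<open>n\<close>; as \<open>f\<close> is irreducible, the ideal would be
  everything and \<open>P\<close> would be zero.\<close>

lemma hankel_det_nonzero:
  fixes f :: "'k::field poly"
  assumes f: "is_min_poly f \<alpha>" and n: "n = Polynomial.degree f"
    and rec: "\<And>j. (\<Sum>i\<le>n. Polynomial.coeff f i * P (i + j)) = 0"
    and P: "P m \<noteq> 0"
  shows "det (Matrix.mat n n (\<lambda>(i, j). P (i + j))) \<noteq> 0"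
proof
  let ?G = "Matrix.mat n n (\<lambda>(i, j). P (i + j))"
  let ?ann = "\<lambda>c. c \<noteq> 0 \<and> (\<forall>g. seq_pairing P (c * g) = 0)"
  assume "det ?G = 0"
  then obtain v where v: "v \<in> carrier_vec n" "v \<noteq> 0\<^sub>v n" "?G *\<^sub>v v = 0\<^sub>v n"
    using det_0_iff_vec_prod_zero_field[of ?G n] by auto
  have f0: "f \<noteq> 0" and n0: "0 < n"
    using is_min_poly_nonzero[OF f] is_min_poly_degree_pos[OF f] n by auto
  have f_ann: "seq_pairing P (f * g) = 0" for g
    by (subst seq_pairing_mult[OF order_refl])
      (simp add: seq_pairing_mult_monom[OF eq_refl[OF n[symmetric]]] rec)
  define c where "c = (\<Sum>j<n. Polynomial.monom (v $ j) j)"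
  have coeff_c: "Polynomial.coeff c j = (if j < n then v $ j else 0)" for j
    by (simp add: c_def coeff_sum)
  have deg_c: "Polynomial.degree c \<le> n - 1"
    by (rule degree_le) (auto simp: coeff_c)
  obtain j where "j < n" "v $ j \<noteq> 0" using v(1,2) by (metis carrier_vecD eq_vecI index_zero_vec)
  hence "c \<noteq> 0" using coeff_c[of j] by auto
  have c_row: "seq_pairing P (c * Polynomial.monom 1 i) = 0" if "i < n" for i
  proof -
    have "seq_pairing P (c * Polynomial.monom 1 i) = (\<Sum>j\<le>n - 1. Polynomial.coeff c j * P (j + i))"
      by (rule seq_pairing_mult_monom[OF deg_c])
    also have "\<dots> = (\<Sum>j<n. P (i + j) * v $ j)"
      using n0 by (intro sum.cong) (auto simp: coeff_c add.commute mult.commute)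
    also have "\<dots> = (?G *\<^sub>v v) $ i"
      using that v(1) by (simp add: scalar_prod_def lessThan_atLeast0)
    finally show ?thesis using v(3) that by simp
  qed
  have c_ann: "seq_pairing P (c * g) = 0" for g
  proof -
    have deg: "Polynomial.degree (g mod f) \<le> n - 1"
      using degree_mod_less[OF f0, of g] n n0 by auto
    have "g = f * (g div f) + g mod f" by simp
    hence "c * g = f * (c * (g div f)) + c * (g mod f)" by (metis distrib_left mult.left_commute)
    hence "seq_pairing P (c * g) = seq_pairing P (c * (g mod f))"
      by (simp add: seq_pairing_add f_ann)
    also have "\<dots> = 0" unfolding seq_pairing_mult[OF deg] using n0 c_row
      by (intro sum.neutral) auto
    finally show ?thesis .
  qed
  \<comment> \<open>\<open>d\<close> generates the annihilator ideal; division with remainder shows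
    that it divides \<open>f\<close>.\<close>
  obtain d where d: "?ann d" and min: "\<And>e. ?ann e \<Longrightarrow> Polynomial.degree d \<le> Polynomial.degree e"
    using ex_has_least_nat[of ?ann c Polynomial.degree] \<open>c \<noteq> 0\<close> c_ann by blast
  have "f mod d = 0"
  proof (rule ccontr)
    assume nz: "f mod d \<noteq> 0"
    have "(f mod d) * g + d * ((f div d) * g) = f * g" for g
      by (metis add.commute distrib_right mult.assoc mult_div_mod_eq)
    hence "seq_pairing P ((f mod d) * g) = 0" for g
      using f_ann[of g] d seq_pairing_add[of P "(f mod d) * g" "d * ((f div d) * g)"] by simp
    hence "Polynomial.degree d \<le> Polynomial.degree (f mod d)" using nz min by blast
    thus False using degree_mod_less[of d f] d nz by auto
  qed
  hence "d dvd f" by (rule mod_0_imp_dvd)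
  then obtain e where e: "f = d * e" by (elim dvdE)
  have "Polynomial.degree d \<le> n - 1" using min[of c] \<open>c \<noteq> 0\<close> c_ann deg_c by force
  moreover have "Polynomial.degree f \<le> Polynomial.degree d + Polynomial.degree e"
    unfolding e by (rule degree_mult_le)
  ultimately have "Polynomial.degree d = 0"
    using is_min_poly_factor[OF f e] n n0 by auto
  then obtain a where a: "d = [:a:]" by (auto elim: degree_eq_zeroE)
  have "seq_pairing P (d * Polynomial.monom 1 m) = a * P m"
    using seq_pairing_smult[of P a "Polynomial.monom 1 m"] by (simp add: a)
  thus False using d P a by auto
qed

subsection \<open>Recurrent sequences in characteristic two\<close>

text \<open>The first factor of the product is the reversed polynomial of \<open>f\<close>, so the
  recurrence at shift \<open>j\<close> is the coefficient of the product at
  \<open>n + j\<close>.\<close>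

lemma reflected_fps_recurrence:
  fixes f :: "'k::field poly" and B P :: "'k fps"
  assumes n: "n = Polynomial.degree f"
    and prod: "Abs_fps (\<lambda>i. if i \<le> n then Polynomial.coeff f (n - i) else 0) * P = B"
    and B: "\<And>i. n \<le> i \<Longrightarrow> fps_nth B i = 0"
  shows "(\<Sum>i\<le>n. Polynomial.coeff f i * fps_nth P (i + j)) = 0"
proof -
  have "0 = fps_nth B (n + j)" by (simp add: B)
  also have "\<dots> = (\<Sum>i=0..n + j. (if i \<le> n then Polynomial.coeff f (n - i) else 0) * fps_nth P (n + j - i))"
    unfolding prod[symmetric] by (simp add: fps_mult_nth)
  also have "\<dots> = (\<Sum>i\<le>n. Polynomial.coeff f (n - i) * fps_nth P (n + j - i))"
    by (rule sum.mono_neutral_cong_right) auto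
  also have "\<dots> = (\<Sum>i\<le>n. Polynomial.coeff f i * fps_nth P (i + j))"
    by (rule sum.reindex_bij_witness[of _ "\<lambda>i. n - i" "\<lambda>i. n - i"]) auto
  finally show ?thesis by simp
qed

text \<open>The terms at \<open>i\<close> and \<open>m - i\<close> cancel in pairs, so only a middle
  term can survive.\<close>

lemma fps_square_nth_char2:
  fixes g :: "'k::field fps"
  assumes char2: "CHAR('k) = 2"
  shows "fps_nth (g * g) m = (if even m then (fps_nth g (m div 2))\<^sup>2 else 0)"
proof -
  let ?t = "\<lambda>i. fps_nth g i * fps_nth g (m - i)"
  let ?L = "{i. 2 * i < m}" and ?U = "{i. i \<le> m \<and> m < 2 * i}" and ?M = "{i. 2 * i = m}"
  have fin: "finite ?L" "finite ?U" "finite ?M"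
    by (rule finite_subset[of _ "{..m}"]; auto)+
  have "fps_nth (g * g) m = (\<Sum>i\<in>?L \<union> ?U \<union> ?M. ?t i)"
    unfolding fps_mult_nth by (rule sum.cong) auto
  also have "\<dots> = (\<Sum>i\<in>?L. ?t i) + (\<Sum>i\<in>?U. ?t i) + (\<Sum>i\<in>?M. ?t i)"
    using fin by (subst sum.union_disjoint; force?)+
  also have "(\<Sum>i\<in>?U. ?t i) = (\<Sum>i\<in>?L. ?t i)"
    by (rule sum.reindex_bij_witness[of _ "\<lambda>i. m - i" "\<lambda>i. m - i"]) (auto simp: mult.commute)
  also have "(\<Sum>i\<in>?L. ?t i) + (\<Sum>i\<in>?L. ?t i) = 0" by (rule double_eq_0_char2[OF char2])
  also have "(\<Sum>i\<in>?M. ?t i) = (if even m then (fps_nth g (m div 2))\<^sup>2 else 0)"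
  proof (cases "even m")
    case True
    hence "?M = {m div 2}" by auto
    moreover have "m - m div 2 = m div 2" using True by auto
    ultimately show ?thesis using True by (simp add: power2_eq_square)
  next
    case False
    hence "?M = {}" by auto
    thus ?thesis using False by simp
  qed
  finally show ?thesis by simp
qed

text \<open>The flags \<open>s\<close> and \<open>t\<close> are true for series supported on even
  exponents and false for series supported on odd ones.\<close>

lemma fps_mult_parity:
  fixes g h :: "'k::field fps"
  assumes "\<And>i. (even i \<noteq> s) \<Longrightarrow> fps_nth g i = 0"
    and "\<And>i. (even i \<noteq> t) \<Longrightarrow> fps_nth h i = 0"
    and "even m \<noteq> (s = t)"
  shows "fps_nth (g * h) m = 0"
  unfolding fps_mult_nth
proof (rule sum.neutral, rule ballI)
  fix i assume "i \<in> {0..m}"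
  hence "even m = (even i = even (m - i))" by (cases "even i"; cases "even m") auto
  hence "even i \<noteq> s \<or> even (m - i) \<noteq> t" using assms(3) by blast
  thus "fps_nth g i * fps_nth h (m - i) = 0" using assms(1)[of i] assms(2)[of "m - i"] by auto
qed

text \<open>If \<open>B\<close> is the even or the odd part of \<open>R\<close>, then \<open>B / R = (B\<^sup>2 + B * (R - B)) / R\<^sup>2\<close>,
  where the second summand is odd and everything else is even.\<close>

lemma fps_parity_part_quotient:
  fixes B R F :: "'k::field fps"
  assumes char2: "CHAR('k) = 2" and RF: "R * F = 1"
    and B: "\<And>i. (even i \<noteq> s) \<Longrightarrow> fps_nth B i = 0"
    and C: "\<And>i. (even i = s) \<Longrightarrow> fps_nth (R - B) i = 0"
  shows "fps_nth (B * F) (2 * i) = (fps_nth (B * F) i)\<^sup>2"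
proof -
  have "B * F = B * F * (R * F)" by (simp add: RF)
  also have "\<dots> = (B * F) * (B * F) + (B * (R - B)) * (F * F)" by (simp add: algebra_simps)
  finally have "fps_nth (B * F) (2 * i) =
      fps_nth ((B * F) * (B * F)) (2 * i) + fps_nth ((B * (R - B)) * (F * F)) (2 * i)"
    by (metis fps_add_nth)
  moreover have "fps_nth ((B * (R - B)) * (F * F)) (2 * i) = 0"
  proof (rule fps_mult_parity[of False _ True])
    show "fps_nth (B * (R - B)) m = 0" if "even m \<noteq> False" for m
      using that by (intro fps_mult_parity[of s _ "\<not> s"] B C) auto
    show "fps_nth (F * F) m = 0" if "even m \<noteq> True" for m
      using that by (simp add: fps_square_nth_char2[OF char2])
  qed simp
  ultimately show ?thesis by (simp add: fps_square_nth_char2[OF char2])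
qed

lemma recurrence_eq_0:
  fixes f :: "'k::field poly"
  assumes "Polynomial.lead_coeff f = 1" "n = Polynomial.degree f"
    and rec: "\<And>j. (\<Sum>i\<le>n. Polynomial.coeff f i * P (i + j)) = 0"
    and init: "\<And>i. i < n \<Longrightarrow> P i = 0"
  shows "P m = 0"
proof (induction m rule: less_induct)
  case (less m)
  show ?case
  proof (cases "m < n")
    case False
    then obtain j where j: "m = n + j" using le_Suc_ex by (metis not_less)
    have "(\<Sum>i\<le>n. Polynomial.coeff f i * P (i + j)) = (\<Sum>i<n. Polynomial.coeff f i * P (i + j)) + P m"
      using assms(1,2) by (simp add: j flip: lessThan_Suc_atMost)
    also have "(\<Sum>i<n. Polynomial.coeff f i * P (i + j)) = 0"
      using less j by (intro sum.neutral) auto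
    finally show ?thesis using rec by simp
  qed (rule init)
qed

lemma fps_reflected_inverse:
  fixes f :: "'k::field poly"
  assumes "Polynomial.lead_coeff f = 1" "n = Polynomial.degree f"
  shows "\<exists>F. Abs_fps (\<lambda>i. if i \<le> n then Polynomial.coeff f (n - i) else 0) * F = 1"
proof -
  let ?R = "Abs_fps (\<lambda>i. if i \<le> n then Polynomial.coeff f (n - i) else 0)"
  have "fps_nth ?R 0 \<noteq> 0" using assms by simp
  hence "?R * inverse ?R = 1" by (metis inverse_mult_eq_1 mult.commute)
  thus ?thesis by blast
qed

lemma separable_square_sequence:
  fixes f :: "'k::field poly"
  assumes char2: "CHAR('k) = 2" and f: "Polynomial.lead_coeff f = 1" "n = Polynomial.degree f"
    and df: "pderiv f \<noteq> 0"
  shows "\<exists>P m. (\<forall>j. (\<Sum>i\<le>n. Polynomial.coeff f i * P (i + j)) = 0) \<and>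
      (\<forall>i. P (2 * i) = (P i)\<^sup>2) \<and> m < n \<and> P m \<noteq> 0"
proof -
  let ?R = "Abs_fps (\<lambda>i. if i \<le> n then Polynomial.coeff f (n - i) else 0)"
  \<comment> \<open>The reversal of \<open>X * f'\<close>, which in characteristic two is the odd
    part of \<open>f\<close>. Hence \<open>B * F\<close> expands \<open>X * f' / f\<close> at
    infinity and generates the traces of the powers of \<alpha> when \<open>f\<close> is its minimal
    polynomial.\<close>
  define B where
    "B = Abs_fps (\<lambda>i. if i \<le> n \<and> odd (n - i) then Polynomial.coeff f (n - i) else 0)"
  have B_nth: "fps_nth B i = (if i \<le> n \<and> odd (n - i) then Polynomial.coeff f (n - i) else 0)" for i
    by (simp add: B_def)
  obtain F where F: "?R * F = 1" using fps_reflected_inverse[OF f] ..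
  let ?P = "\<lambda>i. fps_nth (B * F) i"
  have RP: "?R * (B * F) = B" unfolding mult.left_commute[of ?R] F by simp
  have rec: "(\<Sum>i\<le>n. Polynomial.coeff f i * ?P (i + j)) = 0" for j
    by (rule reflected_fps_recurrence[OF f(2) RP]) (simp add: B_nth)
  have sq: "?P (2 * i) = (?P i)\<^sup>2" for i
  proof (rule fps_parity_part_quotient[OF char2 F, where s = "odd n"])
    show "fps_nth B i = 0" if "even i \<noteq> odd n" for i
      using that by (auto simp: B_nth)
    show "fps_nth (?R - B) i = 0" if "even i = odd n" for i
      using that by (auto simp: B_nth)
  qed
  obtain k where "Polynomial.coeff (pderiv f) k \<noteq> 0" using df by (metis leading_coeff_0_iff)
  hence k: "of_nat (Suc k) \<noteq> (0::'k)" "Polynomial.coeff f (Suc k) \<noteq> 0"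
    by (auto simp: coeff_pderiv simp del: of_nat_Suc)
  have "odd (Suc k)" using k(1) char2 by (metis of_nat_eq_0_iff_char_dvd)
  moreover have "Suc k \<le> n" using k(2) f(2) by (simp add: le_degree)
  ultimately have "fps_nth B (n - Suc k) \<noteq> 0" using k(2) by (simp add: B_nth)
  hence "B \<noteq> 0" by (metis fps_zero_nth)
  \<comment> \<open>The bound on \<open>m\<close> matters: only the first \<open>n\<close> terms
    become square roots of diagonal entries of the Hankel matrix.\<close>
  have "\<exists>m<n. ?P m \<noteq> 0"
  proof (rule ccontr)
    assume "\<not> ?thesis"
    hence "?P m = 0" for m using recurrence_eq_0[OF f, of ?P] rec by blast
    hence "B * F = 0" by (intro fps_ext) simp
    thus False using RP \<open>B \<noteq> 0\<close> by simp
  qed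
  thus ?thesis using rec sq by blast
qed

text \<open>Let \<open>R\<close> be the reversal of \<open>f\<close>, which is an even series. Its
  inverse \<open>F = R * F^2\<close> is even too, so \<open>X * F\<close> is odd, and its
  coefficient at 1 is nonzero.\<close>

lemma inseparable_odd_sequence:
  fixes f :: "'k::field poly"
  assumes char2: "CHAR('k) = 2" and f: "Polynomial.lead_coeff f = 1" "n = Polynomial.degree f"
    and odd: "\<And>i. odd i \<Longrightarrow> Polynomial.coeff f i = 0" and n0: "0 < n"
  shows "\<exists>P. (\<forall>j. (\<Sum>i\<le>n. Polynomial.coeff f i * P (i + j)) = 0) \<and>
      (\<forall>i. P (2 * i) = 0) \<and> P 1 \<noteq> 0"
proof -
  let ?R = "Abs_fps (\<lambda>i. if i \<le> n then Polynomial.coeff f (n - i) else 0)"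
  obtain F where F: "?R * F = 1" using fps_reflected_inverse[OF f] ..
  have "even n" using odd[of n] f by auto
  \<comment> \<open>Needed so that the numerator \<open>fps_X\<close> has no coefficient at or
    beyond \<open>n\<close>.\<close>
  hence n2: "2 \<le> n" using n0 by auto
  let ?P = "\<lambda>i. fps_nth (fps_X * F) i"
  have RP: "?R * (fps_X * F) = fps_X" unfolding mult.left_commute[of ?R] F by simp
  have rec: "(\<Sum>i\<le>n. Polynomial.coeff f i * ?P (i + j)) = 0" for j
    using n2 by (intro reflected_fps_recurrence[OF f(2) RP]) auto
  have "F = ?R * (F * F)" unfolding mult.assoc[symmetric] F by simp
  moreover have "fps_nth (?R * (F * F)) m = 0" if "odd m" for m
  proof (rule fps_mult_parity[of True _ True])
    show "fps_nth ?R i = 0" if "even i \<noteq> True" for i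
      using that \<open>even n\<close> odd by auto
    show "fps_nth (F * F) i = 0" if "even i \<noteq> True" for i
      using that by (simp add: fps_square_nth_char2[OF char2])
  qed (use that in auto)
  ultimately have "fps_nth F m = 0" if "odd m" for m using that by metis
  hence "?P (2 * i) = 0" for i by (simp add: fps_X_mult_nth)
  moreover have "?P 1 \<noteq> 0"
  proof -
    have "fps_nth ?R 0 * fps_nth F 0 = 1" using F by (metis fps_mult_nth_0 fps_one_nth)
    thus ?thesis by (auto simp: fps_X_mult_nth)
  qed
  ultimately show ?thesis using rec by blast
qed

subsection \<open>Symmetric matrices from Hankel forms\<close>

text \<open>\<open>M\<close> is self-adjoint for the form \<open>G\<close>, and \<open>W\<close>
  turns \<open>G\<close> into the standard form, so the conjugate of \<open>M\<close> by
  \<open>W\<close> is symmetric and has the same eigenvalues.\<close>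

lemma symmetric_realization:
  fixes G M W :: "'k::field mat"
  assumes M: "M \<in> carrier_mat N N" and W: "W \<in> carrier_mat N N"
    and G: "G = W * transpose_mat W" and det: "det G \<noteq> 0"
    and sym: "transpose_mat (M * G) = M * G"
    and v: "v \<in> carrier_vec N" "v \<noteq> 0\<^sub>v N" "map_mat to_ac M *\<^sub>v v = \<alpha> \<cdot>\<^sub>v v"
  shows "\<exists>A\<in>carrier_mat N N. symmetric_mat A \<and> ac_eigenvalue A \<alpha>"
proof -
  have WT: "transpose_mat W \<in> carrier_mat N N" using W by simp
  have "det W \<noteq> 0" using det det_mult[OF W WT] by (auto simp: G)
  then obtain V where V: "V \<in> carrier_mat N N" and VW: "V * W = 1\<^sub>m N" and WV: "W * V = 1\<^sub>m N"
    using det_non_zero_imp_unit[OF W] by (auto simp: Units_def ring_mat_def)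
  have VT: "transpose_mat V \<in> carrier_mat N N" using V by simp
  have Gc: "G \<in> carrier_mat N N" using W by (simp add: G)
  let ?A = "V * M * W"
  have A: "?A \<in> carrier_mat N N" using V M W by simp
  have "transpose_mat W * transpose_mat V = 1\<^sub>m N"
    using transpose_mult[OF V W] VW by simp
  hence GV: "G * transpose_mat V = W"
    unfolding G using W V by (subst assoc_mult_mat[OF W WT VT]) simp
  have A_eq: "?A = V * (M * G) * transpose_mat V"
  proof -
    have "V * (M * G) * transpose_mat V = V * (M * (G * transpose_mat V))"
      using V M Gc VT by (simp add: assoc_mult_mat[where ?n\<^sub>1 = N and ?n\<^sub>2 = N and ?n\<^sub>3 = N and ?n\<^sub>4 = N])
    also have "\<dots> = ?A" unfolding GV using V M W by (simp add: assoc_mult_mat[OF V M W])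
    finally show ?thesis by simp
  qed
  have MG: "M * G \<in> carrier_mat N N" using M Gc by simp
  have "transpose_mat ?A = ?A"
  proof -
    have "transpose_mat ?A = V * transpose_mat (V * (M * G))"
      unfolding A_eq using transpose_mult[OF mult_carrier_mat[OF V MG] VT] by simp
    also have "\<dots> = V * (M * G * transpose_mat V)"
      unfolding transpose_mult[OF V MG] sym ..
    also have "\<dots> = ?A" unfolding A_eq using assoc_mult_mat[OF V MG VT] by simp
    finally show ?thesis .
  qed
  moreover have "ac_eigenvalue ?A \<alpha>"
  proof -
    let ?h = "map_mat to_ac :: 'k mat \<Rightarrow> _"
    have c: "?h V \<in> carrier_mat N N" "?h W \<in> carrier_mat N N" "?h M \<in> carrier_mat N N"
      "?h ?A \<in> carrier_mat N N" using V W M by auto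
    let ?u = "?h V *\<^sub>v v"
    have u: "?u \<in> carrier_vec N" using c v by simp
    have "?A * V = V * M"
      using V M W assoc_mult_mat[OF mult_carrier_mat[OF V M] W V] by (simp add: WV)
    hence AV: "?h ?A * ?h V = ?h V * ?h M"
      using to_ac.mat_hom_mult[OF A V] to_ac.mat_hom_mult[OF V M] by simp
    have "?h ?A *\<^sub>v ?u = (?h ?A * ?h V) *\<^sub>v v"
      using assoc_mult_mat_vec[OF c(4) c(1) v(1)] by simp
    also have "\<dots> = ?h V *\<^sub>v (?h M *\<^sub>v v)"
      unfolding AV by (rule assoc_mult_mat_vec[OF c(1) c(3) v(1)])
    also have "\<dots> = \<alpha> \<cdot>\<^sub>v ?u" unfolding v(3) using c(1) v(1) by (simp add: mult_mat_vec)
    finally have eig: "?h ?A *\<^sub>v ?u = \<alpha> \<cdot>\<^sub>v ?u" .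
    have "?h W *\<^sub>v ?u = (?h W * ?h V) *\<^sub>v v"
      using assoc_mult_mat_vec[OF c(2) c(1) v(1)] by simp
    also have "?h W * ?h V = 1\<^sub>m N"
      using to_ac.mat_hom_mult[OF W V] by (simp add: WV to_ac.mat_hom_one)
    finally have "?h W *\<^sub>v ?u = v" using v by simp
    moreover have "?h W *\<^sub>v 0\<^sub>v N = 0\<^sub>v N" using c by auto
    ultimately have "?u \<noteq> 0\<^sub>v N" using v by metis
    thus ?thesis unfolding ac_eigenvalue_def eigenvalue_def eigenvector_def
      using u eig c(4) V by (intro exI[of _ ?u]) auto
  qed
  ultimately show ?thesis using A unfolding symmetric_mat_def by blast
qed

lemma poly_map_to_ac: "poly (map_poly to_ac g) \<alpha> = (\<Sum>i\<le>Polynomial.degree g. to_ac (Polynomial.coeff g i) * \<alpha> ^ i)"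
  by (simp add: poly_altdef coeff_map_poly degree_map_poly)

text \<open>Size \<open>N > n\<close> is needed when the Hankel form is alternating: its orthogonal sum with
  a one-dimensional unit form is no longer so.\<close>

lemma hankel_realization:
  fixes f :: "'k::field poly"
  assumes char2: "CHAR('k) = 2" and f: "is_min_poly f \<alpha>" and n: "n = Polynomial.degree f" and N: "n \<le> N"
    and rec: "\<And>j. (\<Sum>i\<le>n. Polynomial.coeff f i * P (i + j)) = 0"
    and P: "P m \<noteq> 0"
    and diag: "\<And>i. i < n \<Longrightarrow> P (2 * i) = (a i)\<^sup>2"
    and non_alt: "n < N \<or> (\<exists>i<n. a i \<noteq> 0)"
  shows "\<exists>A\<in>carrier_mat N N. symmetric_mat A \<and> ac_eigenvalue A \<alpha>"
proof -
  have n0: "0 < n" using is_min_poly_degree_pos[OF f] n by simp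
  have lead: "Polynomial.coeff f n = 1" using f n by (simp add: is_min_poly_def)
  \<comment> \<open>The Hankel block bordered by an identity block of size \<open>N - n\<close>;
    \<open>b\<close> below holds square roots of the diagonal.\<close>
  define h where "h i j = (if i < n \<and> j < n then P (i + j) else if i = j then 1 else 0)" for i j
  define b where "b i = (if i < n then a i else 1)" for i
  \<comment> \<open>Multiplication by \<alpha> in the basis of its powers, a companion matrix,
    extended by zero.\<close>
  define mm where "mm i k = (if i < n then (if Suc i < n then (if k = Suc i then 1 else 0)
      else if k < n then - Polynomial.coeff f k else 0) else 0)" for i k
  let ?H = "Matrix.mat n n (\<lambda>(i, j). P (i + j))"
  define G where "G = Matrix.mat N N (\<lambda>(i, j). h i j)"
  define M where "M = Matrix.mat N N (\<lambda>(i, k). mm i k)"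
  have Gc: "G \<in> carrier_mat N N" and Mc: "M \<in> carrier_mat N N" by (auto simp: G_def M_def)
  have "\<exists>w. \<forall>i\<in>{0..<N}. \<forall>j\<in>{0..<N}. h i j = (\<Sum>s\<in>{0..<N}. w i s * w j s)"
  proof (rule gram_factor[OF char2])
    show "h i i = (b i)\<^sup>2" for i using diag[of i] by (auto simp: h_def b_def mult_2)
    show "\<exists>i\<in>{0..<N}. b i \<noteq> 0" using non_alt
    proof
      assume "n < N"
      thus ?thesis by (intro bexI[of _ n]) (auto simp: b_def)
    next
      assume "\<exists>i<n. a i \<noteq> 0"
      thus ?thesis using N by (auto simp: b_def)
    qed
  qed (auto simp: h_def add.commute)
  then obtain w where w: "\<And>i j. i < N \<Longrightarrow> j < N \<Longrightarrow> h i j = (\<Sum>s\<in>{0..<N}. w i s * w j s)"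
    by force
  define W where "W = Matrix.mat N N (\<lambda>(i, s). w i s)"
  have Wc: "W \<in> carrier_mat N N" by (simp add: W_def)
  have GW: "G = W * transpose_mat W"
    by (rule eq_matI) (auto simp: G_def W_def scalar_prod_def w)
  have "det G \<noteq> 0"
  proof
    assume "det G = 0"
    then obtain v where v: "v \<in> carrier_vec N" "v \<noteq> 0\<^sub>v N" "G *\<^sub>v v = 0\<^sub>v N"
      using det_0_iff_vec_prod_zero_field[OF Gc] by blast
    have Gv: "(\<Sum>j\<in>{0..<N}. h i j * v $ j) = 0" if "i < N" for i
    proof -
      have "(G *\<^sub>v v) $ i = (\<Sum>j\<in>{0..<N}. h i j * v $ j)"
        using that v(1) by (simp add: G_def scalar_prod_def)
      thus ?thesis using v(3) that by simp
    qed
    have tail: "v $ i = 0" if "n \<le> i" "i < N" for i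
    proof -
      have "(\<Sum>j\<in>{0..<N}. h i j * v $ j) = (\<Sum>j\<in>{0..<N}. if j = i then v $ j else 0)"
        using that by (intro sum.cong) (auto simp: h_def)
      thus ?thesis using Gv that by simp
    qed
    let ?u = "Matrix.vec n (\<lambda>i. v $ i)"
    have "?H *\<^sub>v ?u = 0\<^sub>v n"
    proof (rule eq_vecI)
      fix i assume "i < dim_vec (0\<^sub>v n :: 'k vec)"
      hence i: "i < n" by simp
      have "(?H *\<^sub>v ?u) $ i = (\<Sum>j\<in>{0..<n}. h i j * v $ j)"
        using i by (simp add: scalar_prod_def h_def)
      also have "\<dots> = (\<Sum>j\<in>{0..<N}. h i j * v $ j)"
        using N tail by (intro sum.mono_neutral_left) auto
      finally show "(?H *\<^sub>v ?u) $ i = 0\<^sub>v n $ i" using Gv i N by simp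
    qed simp
    moreover have "det ?H \<noteq> 0" by (rule hankel_det_nonzero[OF f n rec P])
    ultimately have "?u = 0\<^sub>v n"
      using det_0_iff_vec_prod_zero_field[of ?H n] by (metis mat_carrier vec_carrier)
    hence "v $ i = 0" if "i < n" for i using that by (metis index_vec index_zero_vec(1))
    hence "v $ i = 0" if "i < N" for i using tail that by (cases "i < n") auto
    hence "v = 0\<^sub>v N" using v(1) by (intro eq_vecI) auto
    thus False using v(2) by simp
  qed
  \<comment> \<open>On the first block the product has entries \<open>P (i + j + 1)\<close>, by the
    recurrence in the last row, and it is zero elsewhere.\<close>
  moreover have "transpose_mat (M * G) = M * G"
  proof -
    have "(\<Sum>k\<in>{0..<N}. mm i k * h k j) = (if i < n \<and> j < n then P (Suc (i + j)) else 0)"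
      if "i < N" "j < N" for i j
    proof -
      consider "n \<le> i" | "Suc i < n" | "Suc i = n" by linarith
      thus ?thesis
      proof cases
        case 1
        thus ?thesis by (auto simp: mm_def)
      next
        case 2
        have "(\<Sum>k\<in>{0..<N}. mm i k * h k j) = (\<Sum>k\<in>{0..<N}. if k = Suc i then h k j else 0)"
          using 2 by (intro sum.cong) (auto simp: mm_def)
        thus ?thesis using 2 N by (auto simp: h_def)
      next
        case 3
        have "(\<Sum>k\<in>{0..<N}. mm i k * h k j) = (\<Sum>k\<in>{0..<n}. mm i k * h k j)"
          using N 3 by (intro sum.mono_neutral_right) (auto simp: mm_def)
        also have "\<dots> = - (\<Sum>k<n. Polynomial.coeff f k * h k j)"
          using 3 by (auto simp: mm_def sum_negf lessThan_atLeast0)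
        also have "\<dots> = (if j < n then P (n + j) else 0)"
        proof (cases "j < n")
          case True
          have "(\<Sum>k<n. Polynomial.coeff f k * h k j) = (\<Sum>k<n. Polynomial.coeff f k * P (k + j))"
            using True by (simp add: h_def)
          moreover have "(\<Sum>k<n. Polynomial.coeff f k * P (k + j)) + P (n + j) = 0"
            using rec[of j] lead by (simp flip: lessThan_Suc_atMost)
          ultimately show ?thesis using True by (simp add: add_eq_0_iff2)
        next
          case False
          hence "(\<Sum>k<n. Polynomial.coeff f k * h k j) = 0"
            by (intro sum.neutral) (auto simp: h_def)
          thus ?thesis using False by simp
        qed
        finally show ?thesis using 3 by auto
      qed
    qed
    thus ?thesis
      by (intro eq_matI) (auto simp: M_def G_def scalar_prod_def add.commute)
  qed
  moreover
  define v where "v = Matrix.vec N (\<lambda>i. if i < n then \<alpha> ^ i else 0)"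
  have v: "v \<in> carrier_vec N" by (simp add: v_def)
  moreover have "v \<noteq> 0\<^sub>v N"
  proof
    assume "v = 0\<^sub>v N"
    hence "v $ 0 = 0" using n0 N by simp
    thus False using n0 N by (simp add: v_def)
  qed
  moreover have "map_mat to_ac M *\<^sub>v v = \<alpha> \<cdot>\<^sub>v v"
  proof (rule eq_vecI)
    fix i assume "i < dim_vec (\<alpha> \<cdot>\<^sub>v v)"
    hence i: "i < N" by (simp add: v_def)
    have "(map_mat to_ac M *\<^sub>v v) $ i = (\<Sum>k\<in>{0..<N}. to_ac (mm i k) * (if k < n then \<alpha> ^ k else 0))"
      using i by (simp add: M_def v_def scalar_prod_def)
    also have "\<dots> = (\<Sum>k\<in>{0..<n}. to_ac (mm i k) * \<alpha> ^ k)"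
      using N by (intro sum.mono_neutral_cong_right) auto
    also have "\<dots> = (if i < n then \<alpha> ^ Suc i else 0)"
    proof -
      consider "n \<le> i" | "Suc i < n" | "Suc i = n" by linarith
      thus ?thesis
      proof cases
        case 1
        thus ?thesis by (auto simp: mm_def)
      next
        case 2
        have "(\<Sum>k\<in>{0..<n}. to_ac (mm i k) * \<alpha> ^ k) = (\<Sum>k\<in>{0..<n}. if k = Suc i then \<alpha> ^ k else 0)"
          using 2 by (intro sum.cong) (auto simp: mm_def)
        thus ?thesis using 2 by auto
      next
        case 3
        have "(\<Sum>k\<in>{0..<n}. to_ac (mm i k) * \<alpha> ^ k) = - (\<Sum>k<n. to_ac (Polynomial.coeff f k) * \<alpha> ^ k)"
          using 3 by (auto simp: mm_def sum_negf lessThan_atLeast0)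
        moreover have "(\<Sum>k<n. to_ac (Polynomial.coeff f k) * \<alpha> ^ k) + \<alpha> ^ n = 0"
          using f lead unfolding is_min_poly_def poly_map_to_ac n[symmetric]
          by (simp flip: lessThan_Suc_atMost)
        ultimately show ?thesis using 3 by (auto simp: add_eq_0_iff2)
      qed
    qed
    also have "\<dots> = (\<alpha> \<cdot>\<^sub>v v) $ i" using i by (simp add: v_def)
    finally show "(map_mat to_ac M *\<^sub>v v) $ i = (\<alpha> \<cdot>\<^sub>v v) $ i" .
  qed (simp add: M_def v_def)
  ultimately show ?thesis by (intro symmetric_realization[OF Mc Wc GW])
qed

subsection \<open>Symmetric matrices and inseparability\<close>

lemma pow_mat_add:
  fixes A :: "'a::comm_ring_1 mat"
  assumes "A \<in> carrier_mat n n"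
  shows "A ^\<^sub>m (i + j) = A ^\<^sub>m i * A ^\<^sub>m j"
proof (induction j)
  case (Suc j)
  thus ?case using assoc_mult_mat[OF pow_carrier_mat[OF assms] pow_carrier_mat[OF assms] assms] by simp
qed (use assms in simp)

lemma transpose_pow_mat:
  fixes A :: "'a::comm_ring_1 mat"
  assumes "A \<in> carrier_mat n n" "transpose_mat A = A"
  shows "transpose_mat (A ^\<^sub>m i) = A ^\<^sub>m i"
proof (induction i)
  case (Suc i)
  have "transpose_mat (A ^\<^sub>m i * A) = A ^\<^sub>m 1 * A ^\<^sub>m i"
    using transpose_mult[OF pow_carrier_mat[OF assms(1)] assms(1), of i] assms Suc by simp
  also have "\<dots> = A ^\<^sub>m (Suc i)"
    using pow_mat_add[OF assms(1), of 1 i] by simp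
  finally show ?case by simp
qed simp

lemma sqrt_exists_alg_closed:
  fixes x :: "'a::alg_closed_field"
  shows "\<exists>y. y\<^sup>2 = x"
proof -
  have "\<exists>y. poly [:- x, 0, 1:] y = 0" by (rule alg_closed_imp_poly_has_root) simp
  thus ?thesis by (auto simp: power2_eq_square)
qed

lemma coeff_odd_eq_0_char2:
  fixes f :: "'k::field poly"
  assumes "CHAR('k) = 2" "pderiv f = 0" "odd i"
  shows "Polynomial.coeff f i = 0"
proof -
  obtain k where k: "i = Suc k" using assms(3) by (cases i) auto
  have "of_nat (Suc k) * Polynomial.coeff f (Suc k) = 0"
    using assms(2) coeff_pderiv[of f k] by simp
  moreover have "of_nat (Suc k) \<noteq> (0::'k)"
    using assms(1,3) of_nat_eq_0_iff_char_dvd[where ?'a = 'k] k by metis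
  ultimately show ?thesis unfolding k by simp
qed

lemma inseparable_no_symmetric:
  fixes f :: "'k::field poly" and A :: "'k mat"
  assumes char2: "CHAR('k) = 2" and f: "is_min_poly f \<alpha>" and n: "n = Polynomial.degree f"
    and df: "pderiv f = 0"
    and A: "A \<in> carrier_mat n n" and sym: "transpose_mat A = A"
  shows "\<not> ac_eigenvalue A \<alpha>"
proof
  let ?h = "map_mat to_ac :: 'k mat \<Rightarrow> _"
  assume "ac_eigenvalue A \<alpha>"
  then obtain v where ev: "eigenvector (?h A) v \<alpha>"
    by (auto simp: ac_eigenvalue_def eigenvalue_def)
  hence v: "v \<in> carrier_vec n" "v \<noteq> 0\<^sub>v n" using A by (auto simp: eigenvector_def)
  then obtain r where r: "r < n" "v $ r \<noteq> 0" by (metis carrier_vecD eq_vecI index_zero_vec)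
  have hA: "?h A \<in> carrier_mat n n" using A by simp
  define a where "a i s = (A ^\<^sub>m i) $$ (r, s)" for i s
  have Ac: "A ^\<^sub>m i \<in> carrier_mat n n" for i by (rule pow_carrier_mat[OF A])
  have Ad: "dim_row (A ^\<^sub>m i) = n" "dim_col (A ^\<^sub>m i) = n" for i using Ac[of i] by auto
  have a_v: "(\<Sum>s<n. to_ac (a i s) * v $ s) = \<alpha> ^ i * v $ r" for i
  proof -
    have "?h (A ^\<^sub>m i) *\<^sub>v v = \<alpha> ^ i \<cdot>\<^sub>v v"
      using eigenvector_pow[OF hA ev, of i] by (simp add: to_ac.mat_hom_pow[OF A])
    hence "(?h (A ^\<^sub>m i) *\<^sub>v v) $ r = \<alpha> ^ i * v $ r" using r(1) v(1) by simp
    thus ?thesis using r(1) v(1) Ad[of i]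
      by (simp add: scalar_prod_def a_def lessThan_atLeast0)
  qed
  have comb: "(\<Sum>s<n. to_ac (\<Sum>i\<in>I. c i * a (t i) s) * v $ s) = (\<Sum>i\<in>I. to_ac (c i) * \<alpha> ^ t i) * v $ r"
    for I :: "nat set" and c t
  proof -
    have "(\<Sum>s<n. to_ac (\<Sum>i\<in>I. c i * a (t i) s) * v $ s)
        = (\<Sum>s<n. \<Sum>i\<in>I. to_ac (c i) * (to_ac (a (t i) s) * v $ s))"
      by (simp add: to_ac_sum sum_distrib_right mult.assoc)
    also have "\<dots> = (\<Sum>i\<in>I. to_ac (c i) * (\<Sum>s<n. to_ac (a (t i) s) * v $ s))"
      by (subst sum.swap) (simp add: sum_distrib_left)
    finally show ?thesis by (simp add: a_v sum_distrib_right mult.assoc)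
  qed
  have indep: "c i = 0" if "(\<Sum>i<n. to_ac (c i) * \<alpha> ^ i) = 0" "i < n" for c :: "nat \<Rightarrow> 'k" and i
  proof -
    define g where "g = (\<Sum>i<n. Polynomial.monom (c i) i)"
    have coeff_g: "Polynomial.coeff g j = (if j < n then c j else 0)" for j
      by (simp add: g_def coeff_sum)
    have "Polynomial.degree g \<le> n - 1" by (rule degree_le) (auto simp: coeff_g)
    hence deg: "Polynomial.degree g < n" using that(2) by simp
    have "poly (map_poly to_ac g) \<alpha> = (\<Sum>i<n. to_ac (c i) * \<alpha> ^ i)"
      unfolding poly_map_to_ac using deg
      by (intro sum.mono_neutral_cong_left) (auto simp: coeff_g intro!: le_degree)
    hence "g = 0" using is_min_poly_eq_0[OF f _ deg[unfolded n]] that(1) by simp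
    thus ?thesis using coeff_g[of i] that(2) by simp
  qed
  \<comment> \<open>The columns of \<open>K\<close> are the \<open>r\<close>-th rows of the first
    \<open>n\<close> powers of \<open>A\<close>. Pairing with \<open>v\<close> sends them to the
    powers of \<alpha> times \<open>v $ r\<close>, so they are independent.\<close>
  define K where "K = Matrix.mat n n (\<lambda>(s, i). a i s)"
  have Kc: "K \<in> carrier_mat n n" by (simp add: K_def)
  have K_mult: "(K *\<^sub>v c) $ s = (\<Sum>i<n. c $ i * a i s)" if "c \<in> carrier_vec n" "s < n" for c s
    using that by (simp add: K_def scalar_prod_def lessThan_atLeast0 mult.commute)
  have K_inj: "c = 0\<^sub>v n"
    if c: "c \<in> carrier_vec n" and eq: "(\<Sum>s<n. to_ac ((K *\<^sub>v c) $ s) * v $ s) = 0" for c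
  proof -
    have "(\<Sum>i<n. to_ac (c $ i) * \<alpha> ^ i) * v $ r = 0"
      using eq comb[where I = "{..<n}" and c = "\<lambda>i. c $ i" and t = "\<lambda>i. i"] K_mult[OF c] by simp
    hence "c $ i = 0" if "i < n" for i using r(2) indep[of "\<lambda>i. c $ i"] that by simp
    thus ?thesis using c by (intro eq_vecI) auto
  qed
  have detK: "det K \<noteq> 0"
  proof
    assume "det K = 0"
    then obtain c where c: "c \<in> carrier_vec n" "c \<noteq> 0\<^sub>v n" "K *\<^sub>v c = 0\<^sub>v n"
      using det_0_iff_vec_prod_zero_field[OF Kc] by blast
    thus False using K_inj[OF c(1)] by simp
  qed
  \<comment> \<open>The \<open>n\<close> entries of \<open>v\<close> span a space containing \<open>v\<^sub>r k(\<alpha>)\<close>, so they are independent over \<open>k\<close>.\<close>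
  have v_indep: "y s = 0" if y: "(\<Sum>s<n. to_ac (y s) * v $ s) = 0" and s: "s < n" for y s
  proof -
    obtain L where L: "L \<in> carrier_mat n n" "K * L = 1\<^sub>m n"
      using det_non_zero_imp_unit[OF Kc detK] by (auto simp: Units_def ring_mat_def)
    let ?y = "Matrix.vec n y"
    have KL: "K *\<^sub>v (L *\<^sub>v ?y) = ?y"
      using assoc_mult_mat_vec[OF Kc L(1), of ?y] L(2) by simp
    have "L *\<^sub>v ?y = 0\<^sub>v n" by (rule K_inj) (use L(1) y KL in auto)
    hence "?y = K *\<^sub>v 0\<^sub>v n" using KL by simp
    also have "\<dots> = 0\<^sub>v n" using Kc by auto
    finally have "?y $ s = 0\<^sub>v n $ s" by simp
    thus ?thesis using s by simp
  qed
  \<comment> \<open>Only row \<open>r\<close> of \<open>f(A)\<close> times a power of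
    \<open>A\<close> is considered: its pairing with \<open>v\<close> vanishes because
    \<open>f\<close> kills \<alpha>, and the entries of \<open>v\<close> are independent.\<close>
  have rec_a: "(\<Sum>i\<le>n. Polynomial.coeff f i * a (i + j) s) = 0" if "s < n" for j s
  proof (rule v_indep[OF _ that])
    have "(\<Sum>i\<le>n. to_ac (Polynomial.coeff f i) * \<alpha> ^ (i + j)) = poly (map_poly to_ac f) \<alpha> * \<alpha> ^ j"
      by (simp add: poly_map_to_ac n sum_distrib_right power_add mult.assoc)
    also have "\<dots> = 0" using f by (simp add: is_min_poly_def)
    finally show "(\<Sum>s<n. to_ac (\<Sum>i\<le>n. Polynomial.coeff f i * a (i + j) s) * v $ s) = 0"
      by (simp add: comb)
  qed
  define P where "P i = (\<Sum>s<n. a i s)" for i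
  have rec_P: "(\<Sum>i\<le>n. Polynomial.coeff f i * P (i + j)) = 0" for j
  proof -
    have "(\<Sum>i\<le>n. Polynomial.coeff f i * P (i + j)) = (\<Sum>s<n. \<Sum>i\<le>n. Polynomial.coeff f i * a (i + j) s)"
      unfolding P_def sum_distrib_left by (rule sum.swap)
    thus ?thesis using rec_a by simp
  qed
  \<comment> \<open>Otherwise the all-ones vector would lie in the kernel of the transpose of
    \<open>K\<close>.\<close>
  have "\<exists>m. P m \<noteq> 0"
  proof (rule ccontr)
    assume "\<not> ?thesis"
    hence P0: "P m = 0" for m by blast
    let ?e = "Matrix.vec n (\<lambda>_. 1 :: 'k)"
    have "transpose_mat K *\<^sub>v ?e = 0\<^sub>v n"
    proof (rule eq_vecI)
      fix i assume "i < dim_vec (0\<^sub>v n :: 'k vec)"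
      hence "i < n" by simp
      hence "(transpose_mat K *\<^sub>v ?e) $ i = P i"
        by (simp add: K_def P_def scalar_prod_def lessThan_atLeast0)
      thus "(transpose_mat K *\<^sub>v ?e) $ i = 0\<^sub>v n $ i" using P0 \<open>i < n\<close> by simp
    qed (simp add: K_def)
    moreover have "?e \<noteq> 0\<^sub>v n"
    proof
      assume "?e = 0\<^sub>v n"
      hence "?e $ r = 0\<^sub>v n $ r" by simp
      thus False using r(1) by simp
    qed
    ultimately have "det (transpose_mat K) = 0"
      using det_0_iff_vec_prod_zero_field[of "transpose_mat K" n] Kc
      by (meson transpose_carrier_mat vec_carrier)
    thus False using detK det_transpose[OF Kc] by simp
  qed
  then obtain m where m: "P m \<noteq> 0" ..
  let ?H = "Matrix.mat n n (\<lambda>(i, j). P (i + j))"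
  have detH: "det ?H \<noteq> 0" by (rule hankel_det_nonzero[OF f n rec_P m])
  have sq: "a (2 * i) r = (P i)\<^sup>2" for i
  proof -
    have symm: "(A ^\<^sub>m i) $$ (s, r) = a i s" if "s < n" for s
      using transpose_pow_mat[OF A sym, of i] index_transpose_mat(1)[of s "A ^\<^sub>m i" r] Ad[of i] that r(1)
      by (simp add: a_def)
    have "a (2 * i) r = (A ^\<^sub>m i * A ^\<^sub>m i) $$ (r, r)"
      unfolding a_def using pow_mat_add[OF A, of i i] by (simp add: mult_2)
    also have "\<dots> = (\<Sum>s<n. a i s * (A ^\<^sub>m i) $$ (s, r))"
      using r(1) Ad[of i] by (simp add: scalar_prod_def a_def lessThan_atLeast0)
    also have "\<dots> = (\<Sum>s<n. (a i s)\<^sup>2)" using symm by (simp add: power2_eq_square)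
    finally show ?thesis by (simp add: P_def square_sum_char2[OF char2])
  qed
  note odd = coeff_odd_eq_0_char2[OF char2 df]
  have lead: "Polynomial.coeff f n = 1" using f n by (simp add: is_min_poly_def)
  hence "even n" using odd[of n] by auto
  then obtain q where q: "n = 2 * q" by (elim evenE)
  have qn: "q < n" using q is_min_poly_degree_pos[OF f] n by simp
  \<comment> \<open>The recurrence for the entries at \<open>r\<close>, taken at the even shift
    \<open>2 * j\<close>: only even coefficients of \<open>f\<close> occur, so every term involves a
    square \<open>(P (i + j))\<^sup>2\<close>.\<close>
  have rec_sq: "(\<Sum>i\<le>q. Polynomial.coeff f (2 * i) * (P (i + j))\<^sup>2) = 0" for j
  proof -
    have "(\<Sum>i\<le>q. Polynomial.coeff f (2 * i) * (P (i + j))\<^sup>2)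
        = (\<Sum>i\<le>q. Polynomial.coeff f (2 * i) * a (2 * i + 2 * j) r)"
      by (simp flip: sq add: algebra_simps)
    also have "\<dots> = (\<Sum>i\<in>(\<lambda>i. 2 * i) ` {..q}. Polynomial.coeff f i * a (i + 2 * j) r)"
      by (subst sum.reindex) (auto simp: inj_on_def)
    also have "\<dots> = (\<Sum>i\<le>n. Polynomial.coeff f i * a (i + 2 * j) r)"
    proof (rule sum.mono_neutral_left)
      show "\<forall>i\<in>{..n} - (\<lambda>i. 2 * i) ` {..q}. Polynomial.coeff f i * a (i + 2 * j) r = 0"
      proof
        fix i assume i: "i \<in> {..n} - (\<lambda>i. 2 * i) ` {..q}"
        have "odd i"
        proof
          assume "even i"
          then obtain k where "i = 2 * k" by (elim evenE)
          thus False using i q by auto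
        qed
        thus "Polynomial.coeff f i * a (i + 2 * j) r = 0" using odd by simp
      qed
    qed (use q in auto)
    finally show ?thesis using rec_a r(1) by simp
  qed
  have "\<forall>i. \<exists>y. y\<^sup>2 = to_ac (Polynomial.coeff f (2 * i))"
    using sqrt_exists_alg_closed by blast
  \<comment> \<open>Over the closure \<open>f\<close> is the square of the polynomial with
    coefficients \<open>b 0\<close> up to \<open>b q\<close>.\<close>
  then obtain b where b: "\<And>i. (b i)\<^sup>2 = to_ac (Polynomial.coeff f (2 * i))" by metis
  have char2': "CHAR('k alg_closure) = 2" using char2 by simp
  have kernel: "(\<Sum>i\<le>q. b i * to_ac (P (i + j))) = 0" for j
  proof -
    have "(\<Sum>i\<le>q. b i * to_ac (P (i + j)))\<^sup>2 = (\<Sum>i\<le>q. (b i)\<^sup>2 * (to_ac (P (i + j)))\<^sup>2)"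
      by (simp add: square_sum_char2[OF char2'] power_mult_distrib)
    also have "\<dots> = to_ac (\<Sum>i\<le>q. Polynomial.coeff f (2 * i) * (P (i + j))\<^sup>2)"
      by (simp add: b to_ac_sum)
    finally show ?thesis by (simp add: rec_sq)
  qed
  \<comment> \<open>The halved recurrence, padded to length \<open>n\<close>, is a kernel vector of
    the Hankel matrix over the closure; \<open>b q\<close> squares to the leading coefficient
    1.\<close>
  let ?u = "Matrix.vec n (\<lambda>i. if i \<le> q then b i else 0)"
  have "?h ?H *\<^sub>v ?u = 0\<^sub>v n"
  proof (rule eq_vecI)
    fix j assume "j < dim_vec (0\<^sub>v n :: 'k alg_closure vec)"
    hence j: "j < n" by simp
    have "(?h ?H *\<^sub>v ?u) $ j = (\<Sum>i\<in>{0..<n}. to_ac (P (j + i)) * (if i \<le> q then b i else 0))"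
      using j by (simp add: scalar_prod_def)
    also have "\<dots> = (\<Sum>i\<le>q. b i * to_ac (P (i + j)))"
      using qn by (intro sum.mono_neutral_cong_right) (auto simp: mult.commute add.commute)
    finally show "(?h ?H *\<^sub>v ?u) $ j = 0\<^sub>v n $ j" using kernel j by simp
  qed simp
  moreover have "?u \<noteq> 0\<^sub>v n"
  proof
    assume "?u = 0\<^sub>v n"
    hence "?u $ q = 0\<^sub>v n $ q" by simp
    hence "b q = 0" using qn by simp
    thus False using b[of q] q lead by simp
  qed
  ultimately have "det (?h ?H) = 0"
    using det_0_iff_vec_prod_zero_field[of "?h ?H" n] by (meson map_carrier_mat mat_carrier vec_carrier)
  thus False using detH by (simp add: to_ac.hom_det)
qed

section \<open>The separable, inseparable and perfect cases\<close>

lemma separable_realization: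
  fixes \<alpha> :: "'k::field alg_closure"
  assumes char2: "CHAR('k) = 2" and sep: "separable_poly (min_poly \<alpha>)"
  shows "\<exists>A\<in>carrier_mat (alg_degree \<alpha>) (alg_degree \<alpha>). symmetric_mat A \<and> ac_eigenvalue A \<alpha>"
proof -
  note f = is_min_poly_min_poly[of \<alpha>]
  let ?f = "min_poly \<alpha>" and ?n = "alg_degree \<alpha>"
  have n: "?n = Polynomial.degree ?f" by (simp add: alg_degree_def)
  have lead: "Polynomial.lead_coeff ?f = 1" using f by (simp add: is_min_poly_def)
  obtain P m where P: "\<And>j. (\<Sum>i\<le>?n. Polynomial.coeff ?f i * P (i + j)) = 0"
    "\<And>i. P (2 * i) = (P i)\<^sup>2" "m < ?n" "P m \<noteq> 0"
    using separable_square_sequence[OF char2 lead n] sep separable_is_min_poly_iff[OF f] by blast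
  show ?thesis
    \<comment> \<open>The sequence is its own family of square roots: \<open>a\<close> is
      instantiated with \<open>P\<close>.\<close>
    by (rule hankel_realization[OF char2 f n order_refl P(1) P(4) P(2)]) (use P(3,4) in auto)
qed

lemma inseparable_realization:
  fixes \<alpha> :: "'k::field alg_closure"
  assumes char2: "CHAR('k) = 2" and insep: "\<not> separable_poly (min_poly \<alpha>)"
  shows "\<exists>A\<in>carrier_mat (alg_degree \<alpha> + 1) (alg_degree \<alpha> + 1). symmetric_mat A \<and> ac_eigenvalue A \<alpha>"
proof -
  note f = is_min_poly_min_poly[of \<alpha>]
  let ?f = "min_poly \<alpha>" and ?n = "alg_degree \<alpha>"
  have n: "?n = Polynomial.degree ?f" by (simp add: alg_degree_def)
  have n0: "0 < ?n" using is_min_poly_degree_pos[OF f] n by simp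
  have lead: "Polynomial.lead_coeff ?f = 1" using f by (simp add: is_min_poly_def)
  have "pderiv ?f = 0" using insep separable_is_min_poly_iff[OF f] by blast
  then obtain P where P: "\<And>j. (\<Sum>i\<le>?n. Polynomial.coeff ?f i * P (i + j)) = 0"
    "\<And>i. P (2 * i) = 0" "P 1 \<noteq> 0"
    using inseparable_odd_sequence[OF char2 lead n coeff_odd_eq_0_char2[OF char2] n0] by metis
  show ?thesis
    \<comment> \<open>The Hankel form has zero diagonal, so the extra dimension is what makes the
      bordered form non-alternating.\<close>
    by (rule hankel_realization[OF char2 f n _ P(1) P(3), where a = "\<lambda>_. 0"]) (auto simp: P(2))
qed

theorem theorem1p3:
  fixes \<alpha> :: "'k::field alg_closure" and f :: "'k poly" and n :: nat
  assumes "CHAR('k) = 2"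
    and "alg_degree \<alpha> = n"
    and "f = min_poly \<alpha>"
  shows "(separable_poly f \<longrightarrow>
            (\<exists>A \<in> carrier_mat n n. symmetric_mat A \<and> ac_eigenvalue A \<alpha>))
       \<and> (\<not> separable_poly f \<longrightarrow>
            (\<exists>A \<in> carrier_mat (n + 1) (n + 1). symmetric_mat A \<and> ac_eigenvalue A \<alpha>)
          \<and> \<not> (\<exists>A \<in> carrier_mat n n. symmetric_mat A \<and> ac_eigenvalue A \<alpha>))
       \<and> (perfect_field TYPE('k) \<longrightarrow>
            (\<forall>(\<beta> :: 'k alg_closure) m. alg_degree \<beta> = m \<longrightarrow>
               (\<exists>A \<in> carrier_mat m m. symmetric_mat A \<and> ac_eigenvalue A \<beta>)))"
proof -
  let ?f = "min_poly \<alpha>"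
  note f = is_min_poly_min_poly[of \<alpha>]
  have n: "n = Polynomial.degree ?f" using assms(2) by (simp add: alg_degree_def)
  have "\<not> (\<exists>A \<in> carrier_mat n n. symmetric_mat A \<and> ac_eigenvalue A \<alpha>)" if "\<not> separable_poly ?f"
  proof -
    have "pderiv ?f = 0" using that separable_is_min_poly_iff[OF f] by blast
    thus ?thesis
      using inseparable_no_symmetric[OF assms(1) f n] by (auto simp: symmetric_mat_def)
  qed
  moreover have "separable_poly (min_poly \<beta>)" if "perfect_field TYPE('k)" for \<beta> :: "'k alg_closure"
    using that irreducible_is_min_poly[OF is_min_poly_min_poly] by (auto simp: perfect_field_def)
  ultimately show ?thesis
    using separable_realization[OF assms(1)] inseparable_realization[OF assms(1), of \<alpha>] assms(2)
    unfolding assms(3) by blast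
qed

end
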